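(* Let $\mathcal{G}$ be a graph with two edge-length functions $R_0$ and $R_1$ (as in the context), with associated metrics $d_0,d_1$ on the vertex set, and let $\overline{\mathcal{G}}_0$ be the completion of $\mathcal{G}$ with respect to $d_0$. Suppose $\overline{\mathcal{G}}_0$ is weakly connected. If $R_1(u,v)\le R_0(u,v)$ for every edge $[u,v]$, then the pseudometric on $\overline{\mathcal{G}}_0$ induced by $R_1$ (the extension of $d_1$ to $\overline{\mathcal{G}}_0$, again denoted $d_1$) is a metric. If in addition $(\overline{\mathcal{G}}_0,d_0)$ is compact, then $(\overline{\mathcal{G}}_0,d_0)$ and $(\overline{\mathcal{G}}_0,d_1)$ are homeomorphic.
   Context: Graphs. $\mathcal{G}$ is a simple graph with countable vertex set $\mathcal{V}$ and countable edge set $\mathcal{E}$; each vertex has at least one and at most finitely many incident edges. An edge-length (weight) function is a function $R:\mathcal{E}\to(0,\infty)$, written $R(u,v)$ for $[u,v]\in\mathcal{E}$. Metric and completion. A finite path from $u$ to $v$ is a finite sequence of vertices $u=v_0,\dots,v_K=v$ with $[v_k,v_{k+1}]\in\mathcal{E}$. For a length function $R_i$, $d_i(u,v)=\inf_\gamma\sum_k R_i(v_k,v_{k+1})$, the infimum over finite paths $\gamma$ from $u$ to $v$ ($\infty$ if there is none). As a metric space $\mathcal{G}$ is identified with its vertex set, and $\overline{\mathcal{G}}_i$ is the metric completion with respect to $d_i$. When $R_1\le R_0$ on every edge, $d_1\le d_0$ on $\mathcal{V}$, so $d_1$ extends (by continuity) to a pseudometric on $\overline{\mathcal{G}}_0$,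 i.e. possibly $d_1(x,y)=0$ for distinct $x,y$. Paths in the completion. A path in $\overline{\mathcal{G}}_0$ is a sequence $\{v_k\}$ of vertices with $[v_k,v_{k+1}]\in\mathcal{E}$, indexed by a finite set, by the positive integers (a ray), or by the integers (a double ray). It goes from $u\in\overline{\mathcal{G}}_0$ to $v\in\overline{\mathcal{G}}_0$ if it starts at $u$ (or, when infinite in that direction, converges to $u$ in $d_0$) and ends at $v$ (or, when infinite in that direction, converges to $v$ in $d_0$). Weakly connected. $\overline{\mathcal{G}}_0$ is weakly connected if for every pair of distinct points $u,v\in\overline{\mathcal{G}}_0$ there is a finite set $W$ of edges such that every path from $u$ to $v$ contains an edge from $W$. *)

theory Defs
  imports "HOL-Analysis.Analysis"
begin

text \<open>Distances may be infinite (the graph need not be connected), so they take values in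
  \<^typ>\<open>ennreal\<close>.\<close>

definition ext_metric_on :: "'p set \<Rightarrow> ('p \<Rightarrow> 'p \<Rightarrow> ennreal) \<Rightarrow> bool" where
  "ext_metric_on X D \<longleftrightarrow>
     (\<forall>x\<in>X. \<forall>y\<in>X. D x y = 0 \<longleftrightarrow> x = y) \<and>
     (\<forall>x\<in>X. \<forall>y\<in>X. D x y = D y x) \<and>
     (\<forall>x\<in>X. \<forall>y\<in>X. \<forall>z\<in>X. D x z \<le> D x y + D y z)"

definition ext_metric_topology :: "'p set \<Rightarrow> ('p \<Rightarrow> 'p \<Rightarrow> ennreal) \<Rightarrow> 'p topology" where
  "ext_metric_topology X D =
     topology (\<lambda>U. U \<subseteq> X \<and> (\<forall>x\<in>U. \<exists>r>0. {y \<in> X. D x y < r} \<subseteq> U))"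

lemma istopology_ext_metric:
  "istopology (\<lambda>U. U \<subseteq> X \<and> (\<forall>x\<in>U. \<exists>r>0. {y \<in> X. (D x y :: ennreal) < r} \<subseteq> U))"
  unfolding istopology_def
proof (intro conjI allI impI)
  fix S T
  assume S: "S \<subseteq> X \<and> (\<forall>x\<in>S. \<exists>r>0. {y \<in> X. D x y < r} \<subseteq> S)"
    and T: "T \<subseteq> X \<and> (\<forall>x\<in>T. \<exists>r>0. {y \<in> X. D x y < r} \<subseteq> T)"
  show "S \<inter> T \<subseteq> X" using S by blast
  show "\<forall>x\<in>S \<inter> T. \<exists>r>0. {y \<in> X. D x y < r} \<subseteq> S \<inter> T"
  proof
    fix x assume "x \<in> S \<inter> T"
    then obtain r s where "r > 0" "{y \<in> X. D x y < r} \<subseteq> S" "s > 0" "{y \<in> X. D x y < s} \<subseteq> T"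
      using S T by blast
    then show "\<exists>r>0. {y \<in> X. D x y < r} \<subseteq> S \<inter> T"
      by (intro exI[of _ "min r s"]) auto
  qed
next
  fix \<K>
  assume K: "\<forall>S\<in>\<K>. S \<subseteq> X \<and> (\<forall>x\<in>S. \<exists>r>0. {y \<in> X. D x y < r} \<subseteq> S)"
  show "\<Union>\<K> \<subseteq> X" using K by blast
  show "\<forall>x\<in>\<Union>\<K>. \<exists>r>0. {y \<in> X. D x y < r} \<subseteq> \<Union>\<K>"
  proof
    fix x assume "x \<in> \<Union>\<K>"
    then obtain S where "S \<in> \<K>" "x \<in> S" by blast
    then obtain r where "r > 0" "{y \<in> X. D x y < r} \<subseteq> S" using K by blast
    then show "\<exists>r>0. {y \<in> X. D x y < r} \<subseteq> \<Union>\<K>" using \<open>S \<in> \<K>\<close> by blast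
  qed
qed

lemma openin_ext_metric_topology:
  "openin (ext_metric_topology X D) U \<longleftrightarrow>
     U \<subseteq> X \<and> (\<forall>x\<in>U. \<exists>r>0. {y \<in> X. D x y < r} \<subseteq> U)"
  by (simp add: ext_metric_topology_def topology_inverse'[OF istopology_ext_metric])


text \<open>Edges are unordered pairs of distinct vertices.\<close>

definition locally_finite_graph :: "'a set \<Rightarrow> 'a set set \<Rightarrow> bool" where
  "locally_finite_graph V E \<longleftrightarrow>
     countable V \<and> countable E \<and>
     (\<forall>e\<in>E. \<exists>u\<in>V. \<exists>v\<in>V. u \<noteq> v \<and> e = {u, v}) \<and>
     (\<forall>v\<in>V. {e \<in> E. v \<in> e} \<noteq> {} \<and> finite {e \<in> E. v \<in> e})"

definition edge_length_function :: "'a set set \<Rightarrow> ('a set \<Rightarrow> real) \<Rightarrow> bool" where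
  "edge_length_function E R \<longleftrightarrow> (\<forall>e\<in>E. 0 < R e)"

definition finite_path :: "'a set \<Rightarrow> 'a set set \<Rightarrow> 'a list \<Rightarrow> bool" where
  "finite_path V E p \<longleftrightarrow>
     p \<noteq> [] \<and> set p \<subseteq> V \<and> (\<forall>k. Suc k < length p \<longrightarrow> {p ! k, p ! Suc k} \<in> E)"

definition path_length :: "('a set \<Rightarrow> real) \<Rightarrow> 'a list \<Rightarrow> real" where
  "path_length R p = (\<Sum>k<length p - 1. R {p ! k, p ! Suc k})"

text \<open>If no path joins \<open>u\<close> and \<open>v\<close>, the infimum over the empty set is infinite.\<close>

definition graph_dist :: "'a set \<Rightarrow> 'a set set \<Rightarrow> ('a set \<Rightarrow> real) \<Rightarrow> 'a \<Rightarrow> 'a \<Rightarrow> ennreal" where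
  "graph_dist V E R u v =
     (INF p \<in> {p. finite_path V E p \<and> hd p = u \<and> last p = v}. ennreal (path_length R p))"


definition cauchy_seqs :: "'a set \<Rightarrow> ('a \<Rightarrow> 'a \<Rightarrow> ennreal) \<Rightarrow> (nat \<Rightarrow> 'a) set" where
  "cauchy_seqs V d =
     {x. range x \<subseteq> V \<and> (\<forall>\<epsilon>>0. \<exists>N. \<forall>m\<ge>N. \<forall>n\<ge>N. d (x m) (x n) < \<epsilon>)}"

definition cauchy_rel ::
    "'a set \<Rightarrow> ('a \<Rightarrow> 'a \<Rightarrow> ennreal) \<Rightarrow> ((nat \<Rightarrow> 'a) \<times> (nat \<Rightarrow> 'a)) set" where
  "cauchy_rel V d =
     {(x, y). x \<in> cauchy_seqs V d \<and> y \<in> cauchy_seqs V d \<and> (\<lambda>n. d (x n) (y n)) \<longlonglongrightarrow> 0}"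

definition graph_completion :: "'a set \<Rightarrow> ('a \<Rightarrow> 'a \<Rightarrow> ennreal) \<Rightarrow> (nat \<Rightarrow> 'a) set set" where
  "graph_completion V d = cauchy_seqs V d // cauchy_rel V d"

definition vertex_point :: "'a set \<Rightarrow> ('a \<Rightarrow> 'a \<Rightarrow> ennreal) \<Rightarrow> 'a \<Rightarrow> (nat \<Rightarrow> 'a) set" where
  "vertex_point V d v = cauchy_rel V d `` {\<lambda>_. v}"

text \<open>Extension by continuity of a distance on vertices to classes of Cauchy sequences.  For
  \<open>P\<close>, \<open>Q\<close> in the completion with respect to \<open>d\<^sub>0\<close>, taking \<open>d = d\<^sub>0\<close> gives the metric of the
  completion, and taking \<open>d = d\<^sub>1 \<le> d\<^sub>0\<close> gives the induced pseudometric; in both cases the limit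
  exists and does not depend on the representatives.\<close>

definition extended_dist ::
    "('a \<Rightarrow> 'a \<Rightarrow> ennreal) \<Rightarrow> (nat \<Rightarrow> 'a) set \<Rightarrow> (nat \<Rightarrow> 'a) set \<Rightarrow> ennreal" where
  "extended_dist d P Q = (THE l. \<forall>x\<in>P. \<forall>y\<in>Q. (\<lambda>n. d (x n) (y n)) \<longlonglongrightarrow> l)"


datatype 'a graph_path = Finite_Path "'a list" | Ray "nat \<Rightarrow> 'a" | Double_Ray "int \<Rightarrow> 'a"

fun is_path :: "'a set \<Rightarrow> 'a set set \<Rightarrow> 'a graph_path \<Rightarrow> bool" where
  "is_path V E (Finite_Path p) \<longleftrightarrow> finite_path V E p"
| "is_path V E (Ray p) \<longleftrightarrow> range p \<subseteq> V \<and> (\<forall>k. {p k, p (k + 1)} \<in> E)"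
| "is_path V E (Double_Ray p) \<longleftrightarrow> range p \<subseteq> V \<and> (\<forall>k. {p k, p (k + 1)} \<in> E)"

fun path_edges :: "'a graph_path \<Rightarrow> 'a set set" where
  "path_edges (Finite_Path p) = {{p ! k, p ! Suc k} | k. Suc k < length p}"
| "path_edges (Ray p) = {{p k, p (k + 1)} | k. True}"
| "path_edges (Double_Ray p) = {{p k, p (k + 1)} | k. True}"

definition converges_to ::
    "'a set \<Rightarrow> ('a \<Rightarrow> 'a \<Rightarrow> ennreal) \<Rightarrow> (nat \<Rightarrow> 'a) \<Rightarrow> (nat \<Rightarrow> 'a) set \<Rightarrow> bool" where
  "converges_to V d x P \<longleftrightarrow> (\<lambda>n. extended_dist d (vertex_point V d (x n)) P) \<longlonglongrightarrow> 0"

text \<open>Rays are traversed from their initial vertex only.  Since weak connectedness quantifies over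
  ordered pairs of points, this does not lose the reversed rays.\<close>

fun path_from_to ::
    "'a set \<Rightarrow> ('a \<Rightarrow> 'a \<Rightarrow> ennreal) \<Rightarrow> 'a graph_path \<Rightarrow> (nat \<Rightarrow> 'a) set \<Rightarrow> (nat \<Rightarrow> 'a) set \<Rightarrow> bool" where
  "path_from_to V d (Finite_Path p) P Q \<longleftrightarrow>
     P = vertex_point V d (hd p) \<and> Q = vertex_point V d (last p)"
| "path_from_to V d (Ray p) P Q \<longleftrightarrow>
     P = vertex_point V d (p 0) \<and> converges_to V d p Q"
| "path_from_to V d (Double_Ray p) P Q \<longleftrightarrow>
     converges_to V d (\<lambda>n. p (- int n)) P \<and> converges_to V d (\<lambda>n. p (int n)) Q"

definition weakly_connected :: "'a set \<Rightarrow> 'a set set \<Rightarrow> ('a \<Rightarrow> 'a \<Rightarrow> ennreal) \<Rightarrow> bool" where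
  "weakly_connected V E d \<longleftrightarrow>
     (\<forall>P\<in>graph_completion V d. \<forall>Q\<in>graph_completion V d. P \<noteq> Q \<longrightarrow>
        (\<exists>W. finite W \<and> W \<subseteq> E \<and>
             (\<forall>p. is_path V E p \<and> path_from_to V d p P Q \<longrightarrow> path_edges p \<inter> W \<noteq> {})))"

end

theory Submission
  imports Defs
begin

text \<open>Let \<open>P \<noteq> Q\<close> be represented by sequences \<open>x\<close>, \<open>y\<close> of vertices and let the finite edge
  set \<open>W\<close> meet every path between \<open>P\<close> and \<open>Q\<close>.  Consecutive terms far out in \<open>x\<close> are joined by
  paths too \<open>R0\<close>-short to use an edge of \<open>W\<close>, and concatenating such paths gives a ray from \<open>x n\<close> to
  \<open>P\<close> avoiding \<open>W\<close>, unless \<open>x\<close> is eventually constant and \<open>P\<close> is a vertex; likewise for \<open>Q\<close>.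
  Hence, for large \<open>n\<close>, every finite path from \<open>x n\<close> to \<open>y n\<close> meets \<open>W\<close>, so that \<open>d1 P Q\<close> is at
  least the minimum of \<open>R1\<close> on \<open>W\<close>.  When the completion is compact, the identity map is a
  continuous bijection from a compact space onto a Hausdorff space.\<close>

section \<open>Finite paths\<close>

text \<open>This index-free form makes concatenation, reversal and list induction matters of
  rewriting with \<open>successively\<close>.\<close>

lemma finite_path_iff_successively:
  "finite_path V F p \<longleftrightarrow> p \<noteq> [] \<and> set p \<subseteq> V \<and> successively (\<lambda>u v. {u, v} \<in> F) p"
  by (simp add: finite_path_def successively_conv_nth)

lemma path_length_singleton [simp]: "path_length R [v] = 0"
  by (simp add: path_length_def)

lemma path_length_Cons [simp]:
  "path_length R (u # v # p) = R {u, v} + path_length R (v # p)"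
  by (simp add: path_length_def sum.lessThan_Suc_shift del: sum.lessThan_Suc)

text \<open>The junction vertex ends \<open>p\<close> and begins \<open>q\<close>; taking
  \<open>tl q\<close> keeps it from being listed twice.\<close>

lemma finite_path_append:
  assumes "finite_path V F p" "finite_path V F q" "last p = hd q"
  shows "finite_path V F (p @ tl q)"
  using assms
  by (cases q; cases "tl q")
    (auto simp: finite_path_iff_successively successively_append_iff successively_Cons)

lemma path_length_append:
  assumes "p \<noteq> []" "q \<noteq> []" "last p = hd q"
  shows "path_length R (p @ tl q) = path_length R p + path_length R q"
  using assms
proof (induction p rule: induct_list012)
  case (2 v)
  then show ?case by (cases q) auto
qed auto

lemma last_append_tl: "q \<noteq> [] \<Longrightarrow> last p = hd q \<Longrightarrow> last (p @ tl q) = last q"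
  by (cases q) auto

lemma finite_path_rev: "finite_path V F p \<Longrightarrow> finite_path V F (rev p)"
  by (simp add: finite_path_iff_successively insert_commute)

lemma path_length_rev: "path_length R (rev p) = path_length R p"
proof (induction p rule: induct_list012)
  case (3 u v p)
  have "path_length R (rev (u # v # p)) = path_length R (rev (v # p) @ tl [v, u])"
    by simp
  also have "\<dots> = path_length R (rev (v # p)) + path_length R [v, u]"
    by (rule path_length_append) auto
  finally show ?case using 3 by (simp add: insert_commute)
qed (simp_all add: path_length_def)

lemma path_length_nonneg:
  assumes "edge_length_function E R" "finite_path V E p"
  shows "0 \<le> path_length R p"
  using assms unfolding path_length_def finite_path_def edge_length_function_def
  by (intro sum_nonneg) (auto simp: less_eq_real_def)

text \<open>A path in \<open>E\<close> that is not one in \<open>E - W\<close> traverses some edge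
  of \<open>W\<close>, and no other edge contributes negatively. The lemma is applied to
  \<open>R0\<close>, where short paths must avoid \<open>W\<close>, and to \<open>R1\<close>, where
  paths meeting \<open>W\<close> must be long.\<close>

lemma path_length_ge_edge:
  assumes "edge_length_function E R" "finite_path V E p" "\<not> finite_path V (E - W) p"
  shows "\<exists>e\<in>W. e \<in> E \<and> R e \<le> path_length R p"
proof -
  obtain k where k: "Suc k < length p" "{p ! k, p ! Suc k} \<in> E" "{p ! k, p ! Suc k} \<in> W"
    using assms(2,3) unfolding finite_path_def by blast
  have "R {p ! k, p ! Suc k} \<le> path_length R p"
    unfolding path_length_def
    using assms k unfolding finite_path_def edge_length_function_def
    by (intro member_le_sum) (auto simp: less_eq_real_def)
  then show ?thesis using k by blast
qed

lemma finite_edges_length_bound: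
  assumes "edge_length_function E R" "finite W" "W \<subseteq> E"
  obtains c where "c > 0" "\<And>e. e \<in> W \<Longrightarrow> c \<le> R e"
proof
  \<comment> \<open>The extra element \<open>1\<close> keeps the minimum meaningful when
    \<open>W\<close> is empty.\<close>
  show "Min (insert 1 (R ` W)) > 0"
    using assms by (auto simp: edge_length_function_def)
  show "Min (insert 1 (R ` W)) \<le> R e" if "e \<in> W" for e
    using assms(2) that by (intro Min_le) auto
qed


section \<open>Rays\<close>

lemma is_path_mono: "is_path V F p \<Longrightarrow> F \<subseteq> E \<Longrightarrow> is_path V E p"
  by (cases p) (auto simp: finite_path_def)

lemma path_edges_subset: "is_path V F p \<Longrightarrow> path_edges p \<subseteq> F"
  by (cases p) (auto simp: finite_path_def)

text \<open>The shift \<open>m\<close> records that \<open>p\<close> survives as a tail of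
  \<open>p'\<close>, so \<open>p'\<close> inherits the limit of \<open>p\<close>.\<close>

lemma prepend_finite_path:
  assumes "finite_path V F q" "is_path V F (Ray p)" "last q = p 0"
  obtains p' m where "is_path V F (Ray p')" "p' 0 = hd q" "\<And>i. p' (i + m) = p i"
proof -
  have "\<exists>p' m. is_path V F (Ray p') \<and> p' 0 = hd q \<and> (\<forall>i. p' (i + m) = p i)"
    using assms(1,3)
  proof (induction q rule: induct_list012)
    case (2 v)
    then show ?case using assms(2) by (intro exI[of _ p] exI[of _ 0]) auto
  next
    case (3 u v q)
    have "finite_path V F (v # q)" and uv: "u \<in> V" "{u, v} \<in> F"
      using "3.prems"(1) by (auto simp: finite_path_iff_successively)
    then obtain p' m where p': "is_path V F (Ray p')" "p' 0 = v" "\<forall>i. p' (i + m) = p i"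
      using "3.IH"(2) "3.prems"(2) by auto
    have "is_path V F (Ray (case_nat u p'))"
      using p' uv by (auto simp: image_subset_iff split: nat.split)
    then show ?case
      using p' by (intro exI[of _ "case_nat u p'"] exI[of _ "Suc m"]) auto
  qed (simp add: finite_path_def)
  then show ?thesis using that by blast
qed

lemma is_path_Double_Ray:
  assumes "is_path V F (Ray p)" "is_path V F (Ray q)" "p 0 = q 0"
  shows "is_path V F (Double_Ray (\<lambda>k. if 0 \<le> k then q (nat k) else p (nat (- k))))"
proof -
  let ?r = "\<lambda>k :: int. if 0 \<le> k then q (nat k) else p (nat (- k))"
  have "{?r k, ?r (k + 1)} \<in> F" for k
  proof (cases "0 \<le> k")
    case True
    then have "nat (k + 1) = nat k + 1" by simp
    then show ?thesis using assms(2) True by simp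
  next
    case False
    then have "nat (- k) = nat (- (k + 1)) + 1" by simp
    then have "?r k = p (nat (- (k + 1)) + 1)" using False by simp
    moreover have "?r (k + 1) = p (nat (- (k + 1)))"
      \<comment> \<open>At \<open>k = -1\<close> the two rays meet: the right end of the edge is
        \<open>q 0\<close>, which is \<open>p 0\<close>.\<close>
      using False assms(3) by (cases "k = -1") auto
    ultimately show ?thesis using assms(1) by (simp add: insert_commute)
  qed
  then show ?thesis using assms by auto
qed

text \<open>Each piece has distinct endpoints, so it contributes at least one edge and the
  concatenation is infinite. The last conclusion says that the ray eventually stays within the
  pieces from \<open>k\<close> on; this turns estimates on the pieces into convergence of the
  ray.\<close>

lemma concat_finite_paths:
  assumes path: "\<And>k. finite_path V F (q k)"
    and link: "\<And>k. last (q k) = hd (q (Suc k))"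
    and nontriv: "\<And>k. hd (q k) \<noteq> last (q k)"
  obtains p where "is_path V F (Ray p)" "p 0 = hd (q 0)"
    "\<And>k. \<exists>M. \<forall>i\<ge>M. \<exists>j\<ge>k. p i \<in> set (q j)"
proof -
  \<comment> \<open>\<open>L k\<close> joins the pieces \<open>q 0\<close> to \<open>q k\<close>;
    each \<open>L k\<close> is a prefix of all later ones, so their entries agree wherever both are
    defined.\<close>
  define L where "L = rec_nat (q 0) (\<lambda>k l. l @ tl (q (Suc k)))"
  have L0: "L 0 = q 0" and LSuc: "L (Suc k) = L k @ tl (q (Suc k))" for k
    by (simp_all add: L_def)
  have ne: "q k \<noteq> []" for k
    using path by (simp add: finite_path_def)
  have last_L: "last (L k) = last (q k)" for k
    by (induction k) (simp_all add: L0 LSuc last_append_tl ne link)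
  have path_L: "finite_path V F (L k)" for k
    by (induction k) (simp_all add: L0 LSuc finite_path_append path last_L link)
  have len_q: "length (q k) \<ge> 2" for k
    using nontriv[of k] ne[of k] by (cases "q k"; cases "tl (q k)") auto
  have len_L: "k + 1 < length (L k)" for k
  proof (induction k)
    case 0
    show ?case using len_q[of 0] by (simp add: L0)
  next
    case (Suc k)
    then show ?case using len_q[of "Suc k"] by (simp add: LSuc)
  qed
  have mono_L: "\<exists>l. L m = L k @ l" if "k \<le> m" for k m
    using that by (induction m rule: dec_induct) (auto simp: LSuc)
  have stable: "L m ! i = L k ! i" if "i < length (L k)" "i < length (L m)" for i k m
    using that mono_L[of k m] mono_L[of m k] by (cases "k \<le> m") (auto simp: nth_append)
  define p where "p i = L i ! i" for i
  have p_eq: "p i = L m ! i" if "i < length (L m)" for i m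
    unfolding p_def using len_L[of i] that by (intro stable) auto
  \<comment> \<open>\<open>L i\<close> has at least \<open>i + 2\<close> entries, so positions
    \<open>i\<close> and \<open>i + 1\<close> both lie in this one finite path.\<close>
  have "p i \<in> V \<and> {p i, p (i + 1)} \<in> F" for i
    using path_L[of i] len_L[of i] p_eq[of i i] p_eq[of "i + 1" i]
    by (auto simp: finite_path_def)
  then have "is_path V F (Ray p)" by auto
  moreover have "p 0 = hd (q 0)"
    using ne[of 0] by (simp add: p_def L0 hd_conv_nth)
  moreover have "\<exists>M. \<forall>i\<ge>M. \<exists>j\<ge>k. p i \<in> set (q j)" for k
  \<comment> \<open>A position beyond \<open>L k\<close> was filled by a piece added after stage
    \<open>k\<close>. The induction on \<open>m\<close> finds the stage at which position
    \<open>i\<close> first appears.\<close>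
  proof (rule exI[of _ "length (L k)"], intro allI impI)
    fix i assume i: "length (L k) \<le> i"
    have "\<exists>j\<ge>k. L m ! i \<in> set (q j)" if "i < length (L m)" for m
      using that
    proof (induction m)
      case 0
      then show ?case using i mono_L[of 0 k] by auto
    next
      case (Suc m)
      show ?case
      proof (cases "i < length (L m)")
        case True
        then show ?thesis using Suc.IH by (simp add: LSuc nth_append)
      next
        case False
        then have "L (Suc m) ! i = tl (q (Suc m)) ! (i - length (L m))"
          by (simp add: LSuc nth_append)
        moreover have "tl (q (Suc m)) ! (i - length (L m)) \<in> set (tl (q (Suc m)))"
          using False Suc.prems by (intro nth_mem) (auto simp: LSuc)
        ultimately have "L (Suc m) ! i \<in> set (q (Suc m))"
          using ne[of "Suc m"] list.set_sel(2) by fastforce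
        moreover have "k \<le> Suc m"
          using mono_L[of "Suc m" k] i Suc.prems by (cases "k \<le> Suc m") auto
        ultimately show ?thesis by blast
      qed
    qed
    then show "\<exists>j\<ge>k. p i \<in> set (q j)"
      unfolding p_def using len_L[of i] by simp
  qed
  ultimately show ?thesis using that by blast
qed


section \<open>Extended pseudometrics and the completion\<close>

text \<open>Distance zero between distinct points is allowed, so that the axioms also cover the
  extension of \<open>d1\<close> to the completion before it is known to separate points.\<close>

locale ext_pseudometric =
  fixes V :: "'a set" and d :: "'a \<Rightarrow> 'a \<Rightarrow> ennreal"
  assumes refl: "v \<in> V \<Longrightarrow> d v v = 0"
    and sym: "u \<in> V \<Longrightarrow> v \<in> V \<Longrightarrow> d u v = d v u"
    and triangle: "u \<in> V \<Longrightarrow> v \<in> V \<Longrightarrow> w \<in> V \<Longrightarrow> d u w \<le> d u v + d v w"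
begin

lemma quadrangle:
  assumes "u \<in> V" "u' \<in> V" "v \<in> V" "v' \<in> V"
  shows "d u v \<le> d u u' + d u' v' + d v v'"
proof -
  have "d u v \<le> d u u' + d u' v" using assms by (intro triangle)
  also have "\<dots> \<le> d u u' + (d u' v' + d v' v)"
    using assms by (intro add_left_mono triangle)
  finally show ?thesis using assms sym by (simp add: add.assoc)
qed

lemma equiv_cauchy_rel: "equiv (cauchy_seqs V d) (cauchy_rel V d)"
proof (rule equivI)
  have V: "x n \<in> V" if "x \<in> cauchy_seqs V d" for x n
    using that by (auto simp: cauchy_seqs_def)
  show "cauchy_rel V d \<subseteq> cauchy_seqs V d \<times> cauchy_seqs V d"
    by (auto simp: cauchy_rel_def)
  show "refl_on (cauchy_seqs V d) (cauchy_rel V d)"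
    by (auto simp: refl_on_def cauchy_rel_def refl V)
  show "sym (cauchy_rel V d)"
    by (auto simp: sym_def cauchy_rel_def sym V)
  show "trans (cauchy_rel V d)"
  proof (rule transI)
    fix x y z assume xy: "(x, y) \<in> cauchy_rel V d" and yz: "(y, z) \<in> cauchy_rel V d"
    have "(\<lambda>n. d (x n) (y n) + d (y n) (z n)) \<longlonglongrightarrow> 0 + 0"
      using xy yz by (intro tendsto_add) (auto simp: cauchy_rel_def)
    moreover have "\<forall>\<^sub>F n in sequentially. d (x n) (z n) \<le> d (x n) (y n) + d (y n) (z n)"
      using xy yz by (intro always_eventually allI triangle) (auto simp: cauchy_rel_def V)
    ultimately have "(\<lambda>n. d (x n) (z n)) \<longlonglongrightarrow> 0"
      by (intro tendsto_sandwich[of "\<lambda>_. 0" "\<lambda>n. d (x n) (z n)"]) auto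
    then show "(x, z) \<in> cauchy_rel V d"
      using xy yz by (auto simp: cauchy_rel_def)
  qed
qed

lemma const_mem_vertex_point: "v \<in> V \<Longrightarrow> (\<lambda>_. v) \<in> vertex_point V d v"
  by (auto simp: vertex_point_def cauchy_rel_def cauchy_seqs_def refl)

lemma vertex_point_mem: "v \<in> V \<Longrightarrow> vertex_point V d v \<in> graph_completion V d"
  unfolding vertex_point_def graph_completion_def
  by (intro quotientI) (auto simp: cauchy_seqs_def refl)

lemma mem_cauchy_seqs: "P \<in> graph_completion V d \<Longrightarrow> x \<in> P \<Longrightarrow> x \<in> cauchy_seqs V d"
  using in_quotient_imp_subset[OF equiv_cauchy_rel, of P] by (auto simp: graph_completion_def)

lemma mem_V: "P \<in> graph_completion V d \<Longrightarrow> x \<in> P \<Longrightarrow> x n \<in> V"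
  using mem_cauchy_seqs[of P x] by (auto simp: cauchy_seqs_def)

lemma completion_nonempty: "P \<in> graph_completion V d \<Longrightarrow> \<exists>x. x \<in> P"
  using in_quotient_imp_non_empty[OF equiv_cauchy_rel, of P] by (auto simp: graph_completion_def)

lemma completion_related:
  "P \<in> graph_completion V d \<Longrightarrow> x \<in> P \<Longrightarrow> y \<in> P \<Longrightarrow> (\<lambda>n. d (x n) (y n)) \<longlonglongrightarrow> 0"
  using quotient_eq_iff[OF equiv_cauchy_rel, of P P x y]
  unfolding graph_completion_def cauchy_rel_def by simp

lemma completion_eqI:
  assumes "P \<in> graph_completion V d" "Q \<in> graph_completion V d" "x \<in> P" "y \<in> Q"
    "(\<lambda>n. d (x n) (y n)) \<longlonglongrightarrow> 0"
  shows "P = Q"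
proof -
  have "(x, y) \<in> cauchy_rel V d"
    using assms mem_cauchy_seqs by (simp add: cauchy_rel_def)
  then show ?thesis
    using assms(1-4) unfolding graph_completion_def
    by (intro quotient_eqI[OF equiv_cauchy_rel, of P Q x y])
qed

end

lemma ennreal_half_add_half: "(a :: ennreal) / 2 + a / 2 = a"
proof -
  have "a / 2 + a / 2 = a * 2 / 2"
    by (simp only: mult_2_right add_divide_distrib_ennreal)
  also have "\<dots> = a" by (rule ennreal_mult_divide_eq) auto
  finally show ?thesis .
qed

text \<open>The Cauchy condition is stated additively so that infinite terms are harmless. Bounding
  first over \<open>m\<close> and then over \<open>n\<close> gives \<open>limsup a\<close> at most
  \<open>liminf a\<close> plus any positive \<open>e\<close>.\<close>

lemma ennreal_convergent_if_Cauchy: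
  fixes a :: "nat \<Rightarrow> ennreal"
  assumes "\<And>\<epsilon>. \<epsilon> > 0 \<Longrightarrow> \<exists>N. \<forall>m\<ge>N. \<forall>n\<ge>N. a m \<le> a n + \<epsilon>"
  shows "\<exists>l. a \<longlonglongrightarrow> l"
proof -
  have "limsup a \<le> liminf a"
  proof (rule ennreal_le_epsilon)
    fix e :: real assume "0 < e"
    then obtain N where N: "\<And>m n. m \<ge> N \<Longrightarrow> n \<ge> N \<Longrightarrow> a m \<le> a n + ennreal e"
      using assms[of "ennreal e"] by auto
    have "limsup a \<le> a n + ennreal e" if "n \<ge> N" for n
      using N that by (intro Limsup_bounded) (auto simp: eventually_sequentially)
    then have "\<forall>\<^sub>F n in sequentially. limsup a - ennreal e \<le> a n"
      unfolding eventually_sequentially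
      by (intro exI[of _ N]) (auto simp: ennreal_minus_le_iff add.commute)
    then have "limsup a - ennreal e \<le> liminf a"
      by (rule Liminf_bounded)
    then show "limsup a \<le> liminf a + ennreal e"
      by (auto simp: ennreal_minus_le_iff add.commute)
  qed
  then have "liminf a = limsup a"
    by (intro antisym Liminf_le_Limsup) auto
  then have "a \<longlonglongrightarrow> limsup a"
    by (intro Liminf_eq_Limsup) auto
  then show ?thesis by blast
qed

text \<open>Points are classes of \<open>d\<close>-Cauchy sequences, while the distance being
  extended is \<open>d'\<close>. The pair \<open>d0\<close>, \<open>d0\<close> yields the metric of
  the completion and the pair \<open>d0\<close>, \<open>d1\<close> the induced pseudometric.\<close>

locale dominated_ext_pseudometric =
  dom: ext_pseudometric V d + ext_pseudometric V d' for V :: "'a set" and d d' +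
  assumes dominated: "u \<in> V \<Longrightarrow> v \<in> V \<Longrightarrow> d' u v \<le> d u v"
begin

lemma convergent_dist:
  assumes x: "x \<in> cauchy_seqs V d" and y: "y \<in> cauchy_seqs V d"
  shows "\<exists>l. (\<lambda>n. d' (x n) (y n)) \<longlonglongrightarrow> l"
proof (rule ennreal_convergent_if_Cauchy)
  fix \<epsilon> :: ennreal assume "\<epsilon> > 0"
  then have "\<epsilon> / 2 > 0" by (simp add: ennreal_zero_less_divide)
  then have "\<exists>M. \<forall>m\<ge>M. \<forall>n\<ge>M. d (x m) (x n) < \<epsilon> / 2" "\<exists>N. \<forall>m\<ge>N. \<forall>n\<ge>N. d (y m) (y n) < \<epsilon> / 2"
    using x y by (simp_all add: cauchy_seqs_def)
  then obtain M N where M: "\<And>m n. m \<ge> M \<Longrightarrow> n \<ge> M \<Longrightarrow> d (x m) (x n) < \<epsilon> / 2"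
    and N: "\<And>m n. m \<ge> N \<Longrightarrow> n \<ge> N \<Longrightarrow> d (y m) (y n) < \<epsilon> / 2"
    by metis
  have V: "x n \<in> V" "y n \<in> V" for n using x y by (auto simp: cauchy_seqs_def)
  have "d' (x m) (y m) \<le> d' (x n) (y n) + \<epsilon>" if "m \<ge> max M N" "n \<ge> max M N" for m n
  proof -
    have "d' (x m) (y m) \<le> d' (x m) (x n) + d' (x n) (y n) + d' (y m) (y n)"
      by (intro quadrangle V)
    also have "\<dots> \<le> \<epsilon> / 2 + d' (x n) (y n) + \<epsilon> / 2"
      using M[of m n] N[of m n] dominated[OF V(1)[of m] V(1)[of n]]
        dominated[OF V(2)[of m] V(2)[of n]] that
      by (intro add_mono) auto
    also have "\<dots> = d' (x n) (y n) + (\<epsilon> / 2 + \<epsilon> / 2)" by (simp add: ac_simps)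
    also have "\<epsilon> / 2 + \<epsilon> / 2 = \<epsilon>" by (rule ennreal_half_add_half)
    finally show ?thesis .
  qed
  then show "\<exists>N. \<forall>m\<ge>N. \<forall>n\<ge>N. d' (x m) (y m) \<le> d' (x n) (y n) + \<epsilon>" by blast
qed

text \<open>Changing representatives alters the \<open>d'\<close>-distances by at most the
  \<open>d\<close>-distances between old and new representatives, which tend to zero. Used in both
  directions, this makes the description in \<open>extended_dist\<close> unique.\<close>

lemma limit_dist_le:
  assumes PQ: "P \<in> graph_completion V d" "Q \<in> graph_completion V d"
    and mem: "x \<in> P" "x' \<in> P" "y \<in> Q" "y' \<in> Q"
    and lim: "(\<lambda>n. d' (x n) (y n)) \<longlonglongrightarrow> l" "(\<lambda>n. d' (x' n) (y' n)) \<longlonglongrightarrow> l'"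
  shows "l \<le> l'"
proof -
  have V: "x n \<in> V" "x' n \<in> V" "y n \<in> V" "y' n \<in> V" for n
    using PQ mem dom.mem_V by auto
  have "(\<lambda>n. d (x n) (x' n) + d' (x' n) (y' n) + d (y n) (y' n)) \<longlonglongrightarrow> 0 + l' + 0"
    using PQ mem by (intro tendsto_add lim dom.completion_related)
  moreover have "d' (x n) (y n) \<le> d (x n) (x' n) + d' (x' n) (y' n) + d (y n) (y' n)" for n
  proof -
    have "d' (x n) (y n) \<le> d' (x n) (x' n) + d' (x' n) (y' n) + d' (y n) (y' n)"
      by (intro quadrangle V)
    also have "\<dots> \<le> d (x n) (x' n) + d' (x' n) (y' n) + d (y n) (y' n)"
      by (intro add_mono dominated V order.refl)
    finally show ?thesis .
  qed
  ultimately show ?thesis using lim(1) by (auto intro: LIMSEQ_le)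
qed

lemma tendsto_extended_dist:
  assumes PQ: "P \<in> graph_completion V d" "Q \<in> graph_completion V d"
    and mem: "x \<in> P" "y \<in> Q"
  shows "(\<lambda>n. d' (x n) (y n)) \<longlonglongrightarrow> extended_dist d' P Q"
proof -
  have ex: "\<exists>l. (\<lambda>n. d' (u n) (v n)) \<longlonglongrightarrow> l" if "u \<in> P" "v \<in> Q" for u v
    using convergent_dist PQ that dom.mem_cauchy_seqs by blast
  obtain l where l: "(\<lambda>n. d' (x n) (y n)) \<longlonglongrightarrow> l" using ex mem by blast
  have "(\<lambda>n. d' (u n) (v n)) \<longlonglongrightarrow> l" if uv: "u \<in> P" "v \<in> Q" for u v
  proof -
    obtain l' where l': "(\<lambda>n. d' (u n) (v n)) \<longlonglongrightarrow> l'" using ex[OF uv] by blast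
    have "l' = l"
      using limit_dist_le[OF PQ mem(1) uv(1) mem(2) uv(2) l l']
        limit_dist_le[OF PQ uv(1) mem(1) uv(2) mem(2) l' l] by simp
    then show ?thesis using l' by simp
  qed
  then have "\<forall>u\<in>P. \<forall>v\<in>Q. (\<lambda>n. d' (u n) (v n)) \<longlonglongrightarrow> extended_dist d' P Q"
    unfolding extended_dist_def
    by (rule_tac theI[where a = l]) (use mem LIMSEQ_unique in blast)+
  then show ?thesis using mem by blast
qed

lemma extended_dist_le:
  assumes "P \<in> graph_completion V d" "Q \<in> graph_completion V d" "x \<in> P" "y \<in> Q"
    and "\<And>n. n \<ge> N \<Longrightarrow> d' (x n) (y n) \<le> c"
  shows "extended_dist d' P Q \<le> c"
  using tendsto_extended_dist[OF assms(1-4)] assms(5) by (intro LIMSEQ_le_const2) auto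

lemma extended_dist_ge:
  assumes "P \<in> graph_completion V d" "Q \<in> graph_completion V d" "x \<in> P" "y \<in> Q"
    and "\<And>n. n \<ge> N \<Longrightarrow> c \<le> d' (x n) (y n)"
  shows "c \<le> extended_dist d' P Q"
  using tendsto_extended_dist[OF assms(1-4)] assms(5) by (intro LIMSEQ_le_const) auto

sublocale extended: ext_pseudometric "graph_completion V d" "extended_dist d'"
proof
  fix P Q S
  assume P: "P \<in> graph_completion V d"
  then obtain x where x: "x \<in> P" using dom.completion_nonempty by blast
  have "extended_dist d' P P \<le> 0"
    using P x by (intro extended_dist_le[of _ _ x x]) (auto simp: refl dom.mem_V)
  then show "extended_dist d' P P = 0" by simp
  assume Q: "Q \<in> graph_completion V d"
  then obtain y where y: "y \<in> Q" using dom.completion_nonempty by blast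
  have "(\<lambda>n. d' (x n) (y n)) = (\<lambda>n. d' (y n) (x n))"
    using P Q x y by (auto simp: sym dom.mem_V)
  then show "extended_dist d' P Q = extended_dist d' Q P"
    using tendsto_extended_dist[OF P Q x y] tendsto_extended_dist[OF Q P y x] LIMSEQ_unique
    by fastforce
  assume S: "S \<in> graph_completion V d"
  then obtain z where z: "z \<in> S" using dom.completion_nonempty by blast
  have "(\<lambda>n. d' (x n) (y n) + d' (y n) (z n)) \<longlonglongrightarrow> extended_dist d' P Q + extended_dist d' Q S"
    using P Q S x y z by (intro tendsto_add tendsto_extended_dist)
  moreover have "d' (x n) (z n) \<le> d' (x n) (y n) + d' (y n) (z n)" for n
    using P Q S x y z by (intro triangle) (auto simp: dom.mem_V)
  ultimately show "extended_dist d' P S \<le> extended_dist d' P Q + extended_dist d' Q S"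
    using tendsto_extended_dist[OF P S x z] by (auto intro: LIMSEQ_le)
qed

end

lemma (in ext_pseudometric) dominated_self: "dominated_ext_pseudometric V d d"
  by unfold_locales auto

lemma (in dominated_ext_pseudometric) extended_dist_mono:
  assumes P: "P \<in> graph_completion V d" and Q: "Q \<in> graph_completion V d"
  shows "extended_dist d' P Q \<le> extended_dist d P Q"
proof -
  interpret self: dominated_ext_pseudometric V d d by (rule dom.dominated_self)
  obtain x y where "x \<in> P" "y \<in> Q" using P Q dom.completion_nonempty by blast
  then show ?thesis
    using P Q tendsto_extended_dist self.tendsto_extended_dist
    by (intro LIMSEQ_le[of "\<lambda>n. d' (x n) (y n)" _ "\<lambda>n. d (x n) (y n)"])
      (auto simp: dominated dom.mem_V)
qed


section \<open>The graph distance\<close>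

lemma graph_dist_less_iff:
  "graph_dist V E R u v < c \<longleftrightarrow>
     (\<exists>p. finite_path V E p \<and> hd p = u \<and> last p = v \<and> ennreal (path_length R p) < c)"
  by (auto simp: graph_dist_def INF_less_iff)

lemma graph_dist_le:
  "finite_path V E p \<Longrightarrow> graph_dist V E R (hd p) (last p) \<le> ennreal (path_length R p)"
  unfolding graph_dist_def by (intro INF_lower) auto

lemma graph_dist_sym_le: "graph_dist V E R u v \<le> graph_dist V E R v u"
  unfolding graph_dist_def[of V E R v u]
proof (intro INF_greatest)
  fix p assume "p \<in> {p. finite_path V E p \<and> hd p = v \<and> last p = u}"
  then have p: "finite_path V E p" "hd p = v" "last p = u" "p \<noteq> []"
    by (auto simp: finite_path_def)
  then show "graph_dist V E R u v \<le> ennreal (path_length R p)"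
    using graph_dist_le[OF finite_path_rev[OF p(1)], of R]
    by (simp add: path_length_rev hd_rev last_rev)
qed

text \<open>This is the triangle inequality for infima over paths. Subtraction transfers one summand
  at a time across the inequality, which requires that summand to be finite; if it is infinite, the
  right-hand side is infinite anyway.\<close>

lemma ennreal_le_INF_add:
  fixes c :: ennreal
  assumes "\<And>a b. a \<in> A \<Longrightarrow> b \<in> B \<Longrightarrow> c \<le> f a + g b"
  shows "c \<le> (INF a\<in>A. f a) + (INF b\<in>B. g b)"
proof (cases "(INF a\<in>A. f a) = top")
  case False
  have "c \<le> (INF a\<in>A. f a) + g b" if b: "b \<in> B" for b
  proof (cases "g b = top")
    case False
    then have "c - g b \<le> f a" if "a \<in> A" for a
      using assms[OF that b] by (simp add: ennreal_minus_le_iff add.commute)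
    then have "c - g b \<le> (INF a\<in>A. f a)" by (rule INF_greatest)
    then show ?thesis using False by (simp add: ennreal_minus_le_iff add.commute)
  qed simp
  then have "c - (INF a\<in>A. f a) \<le> (INF b\<in>B. g b)"
    using False by (intro INF_greatest) (auto simp: ennreal_minus_le_iff)
  then show ?thesis using False by (simp add: ennreal_minus_le_iff)
qed simp

lemma ext_pseudometric_graph_dist:
  assumes R: "edge_length_function E R"
  shows "ext_pseudometric V (graph_dist V E R)"
proof
  fix u v w assume "u \<in> V"
  then show "graph_dist V E R u u = 0"
    using graph_dist_le[of V E "[u]" R] by (simp add: finite_path_def)
  show "graph_dist V E R u v = graph_dist V E R v u"
    by (intro antisym graph_dist_sym_le)
  show "graph_dist V E R u w \<le> graph_dist V E R u v + graph_dist V E R v w"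
    unfolding graph_dist_def[of V E R u v] graph_dist_def[of V E R v w]
  proof (rule ennreal_le_INF_add)
    fix p q
    assume "p \<in> {p. finite_path V E p \<and> hd p = u \<and> last p = v}"
      and "q \<in> {q. finite_path V E q \<and> hd q = v \<and> last q = w}"
    then have p: "finite_path V E p" "hd p = u" "last p = v"
      and q: "finite_path V E q" "hd q = v" "last q = w" by auto
    have ne: "p \<noteq> []" "q \<noteq> []" using p q by (auto simp: finite_path_def)
    have "graph_dist V E R (hd (p @ tl q)) (last (p @ tl q)) \<le> ennreal (path_length R (p @ tl q))"
      using p q by (intro graph_dist_le finite_path_append) auto
    then show "graph_dist V E R u w \<le> ennreal (path_length R p) + ennreal (path_length R q)"
      using p q ne path_length_nonneg[OF R p(1)] path_length_nonneg[OF R q(1)]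
      by (simp add: last_append_tl path_length_append)
  qed
qed

lemma graph_dist_mono:
  assumes "\<forall>e\<in>E. R' e \<le> R e"
  shows "graph_dist V E R' u v \<le> graph_dist V E R u v"
  unfolding graph_dist_def path_length_def using assms
  by (intro INF_mono) (auto simp: finite_path_def intro!: ennreal_leI sum_mono)

text \<open>The initial segment of \<open>p\<close> ending at \<open>v\<close> is no longer than
  \<open>p\<close>. Hence all vertices of a short connecting path stay near its start, not only its
  end.\<close>

lemma graph_dist_le_on_path:
  assumes R: "edge_length_function E R" and p: "finite_path V E p" and v: "v \<in> set p"
  shows "graph_dist V E R (hd p) v \<le> ennreal (path_length R p)"
proof -
  obtain ys zs where p_eq: "p = ys @ v # zs" using v by (meson split_list)
  have paths: "finite_path V E (ys @ [v])" "finite_path V E (v # zs)"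
    using p unfolding p_eq
    by (auto simp: finite_path_iff_successively successively_append_iff successively_Cons)
  have "path_length R ((ys @ [v]) @ tl (v # zs)) = path_length R (ys @ [v]) + path_length R (v # zs)"
    by (rule path_length_append) auto
  then have "path_length R (ys @ [v]) \<le> path_length R p"
    using path_length_nonneg[OF R paths(2)] by (simp add: p_eq)
  moreover have "hd (ys @ [v]) = hd p" by (simp add: p_eq hd_append)
  ultimately show ?thesis
    using graph_dist_le[OF paths(1), of R] by (auto intro: order_trans ennreal_leI)
qed

text \<open>A single edge of \<open>W\<close> already costs at least \<open>c\<close>. The path is
  returned both as one in \<open>E - W\<close>, for building rays, and as one in \<open>E\<close>,
  for length estimates.\<close>

lemma short_path_avoiding:
  assumes R: "edge_length_function E R" and c: "\<And>e. e \<in> W \<Longrightarrow> c \<le> R e"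
    and less: "graph_dist V E R u v < ennreal r" "r \<le> c"
  obtains p where "finite_path V (E - W) p" "finite_path V E p" "hd p = u" "last p = v"
    "ennreal (path_length R p) < ennreal r"
proof -
  obtain p where p: "finite_path V E p" "hd p = u" "last p = v"
    "ennreal (path_length R p) < ennreal r"
    using less(1) unfolding graph_dist_less_iff by blast
  have "path_length R p < r"
    using p(4) path_length_nonneg[OF R p(1)] by (simp add: ennreal_less_iff)
  then have "finite_path V (E - W) p"
    using path_length_ge_edge[OF R p(1), of W] c less(2) by force
  then show ?thesis using that p by blast
qed


section \<open>Weak connectedness\<close>

text \<open>The alternatives correspond to \<open>x\<close> being eventually constant or not. The
  ray starts at \<open>x n\<close> itself and is available for every large \<open>n\<close>, so that
  it can be attached to any finite path from \<open>x n\<close> to a term of a sequence representing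
  another point.\<close>

lemma vertex_point_or_ray:
  fixes V :: "'a set" and E :: "'a set set" and R :: "'a set \<Rightarrow> real"
  defines "d \<equiv> graph_dist V E R"
  assumes R: "edge_length_function E R"
    and P: "P \<in> graph_completion V d" "x \<in> P"
    and W: "finite W" "W \<subseteq> E"
  obtains N where "\<And>n. n \<ge> N \<Longrightarrow> P = vertex_point V d (x n) \<or>
    (\<exists>p. is_path V (E - W) (Ray p) \<and> p 0 = x n \<and> converges_to V d p P)"
proof -
  interpret ext_pseudometric V d
    unfolding d_def using R by (rule ext_pseudometric_graph_dist)
  interpret self: dominated_ext_pseudometric V d d by (rule dominated_self)
  have xV: "x n \<in> V" for n using P by (rule mem_V)
  show ?thesis
  proof (cases "\<exists>v. \<forall>\<^sub>F n in sequentially. x n = v")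
    case True
    then obtain v N where N: "\<And>n. n \<ge> N \<Longrightarrow> x n = v"
      unfolding eventually_sequentially by blast
    then have v: "v \<in> V" using xV[of N] by simp
    have "(\<lambda>n. d (x n) v) \<longlonglongrightarrow> 0"
      using N refl[OF v] by (intro tendsto_eventually) (auto simp: eventually_sequentially)
    then have "P = vertex_point V d v"
      using v P by (intro completion_eqI) (auto intro: vertex_point_mem const_mem_vertex_point)
    then show ?thesis using that N by blast
  next
    case False
    \<comment> \<open>Later terms different from \<open>x n\<close> provide the distinct endpoints
      that the concatenation of paths requires.\<close>
    then have move: "\<exists>m\<ge>M. x m \<noteq> x n" for M n
      unfolding eventually_sequentially by blast
    obtain c where c: "c > 0" "\<And>e. e \<in> W \<Longrightarrow> c \<le> R e"
      using finite_edges_length_bound[OF R W] by blast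
    \<comment> \<open>\<open>\<epsilon> 0 = c\<close>, so already the first connecting path is too short to meet \<open>W\<close>.\<close>
    define \<epsilon> where "\<epsilon> k = c / real (Suc k)" for k
    have eps_pos: "\<epsilon> k > 0" and eps_le: "\<epsilon> k \<le> c" for k
      using c(1) by (auto simp: \<epsilon>_def field_simps)
    have eps_antimono: "\<epsilon> j \<le> \<epsilon> k" if "k \<le> j" for j k
      using c(1) that unfolding \<epsilon>_def by (intro divide_left_mono) auto
    define tail where "tail k s \<longleftrightarrow> (\<forall>m\<ge>s. \<forall>n\<ge>s. d (x m) (x n) < ennreal (\<epsilon> k))" for k s
    have tail_ex: "\<exists>s. tail k s" for k
      using mem_cauchy_seqs[OF P] eps_pos unfolding tail_def cauchy_seqs_def by auto
    have tail_mono: "tail k s \<Longrightarrow> s \<le> t \<Longrightarrow> tail k t" for k s t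
      unfolding tail_def by auto
    obtain N where N: "tail 0 N" using tail_ex by blast
    show ?thesis
    proof (rule that[of N], rule disjI2)
      fix n assume "n \<ge> N"
      then have start: "tail 0 n" using N tail_mono by blast
      have step: "\<exists>t. tail (Suc k) t \<and> s \<le> t \<and> x s \<noteq> x t" for k s
      proof -
        obtain s' where "tail (Suc k) s'" using tail_ex by blast
        moreover obtain t where "t \<ge> max s s'" "x t \<noteq> x s" using move by blast
        ultimately show ?thesis using tail_mono[of "Suc k" s' t] by (intro exI[of _ t]) auto
      qed
      have "\<exists>s. s 0 = n \<and> (\<forall>k. tail k (s k)) \<and> (\<forall>k. s k \<le> s (Suc k) \<and> x (s k) \<noteq> x (s (Suc k)))"
      proof -
        \<comment> \<open>The clause for \<open>k = 0\<close> is part of the invariant because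
          dependent choice by itself does not fix the initial value.\<close>
        have "\<exists>s. \<forall>k. (tail k (s k) \<and> (k = 0 \<longrightarrow> s k = n)) \<and> (s k \<le> s (Suc k) \<and> x (s k) \<noteq> x (s (Suc k)))"
          by (rule dependent_nat_choice) (use start step in auto)
        then show ?thesis by metis
      qed
      then obtain s where s0: "s 0 = n" and tail: "\<And>k. tail k (s k)"
        and s_le: "\<And>k. s k \<le> s (Suc k)" and s_ne: "\<And>k. x (s k) \<noteq> x (s (Suc k))" by blast
      have "\<exists>q. finite_path V (E - W) q \<and> finite_path V E q \<and> hd q = x (s k)
          \<and> last q = x (s (Suc k)) \<and> ennreal (path_length R q) < ennreal (\<epsilon> k)" for k
      proof -
        have "graph_dist V E R (x (s k)) (x (s (Suc k))) < ennreal (\<epsilon> k)"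
          using tail[of k] s_le[of k] unfolding tail_def d_def by auto
        then show ?thesis
          using short_path_avoiding[OF R c(2) _ eps_le] by metis
      qed
      then obtain q where q: "\<And>k. finite_path V (E - W) (q k)" "\<And>k. finite_path V E (q k)"
          "\<And>k. hd (q k) = x (s k)" "\<And>k. last (q k) = x (s (Suc k))"
          "\<And>k. ennreal (path_length R (q k)) < ennreal (\<epsilon> k)"
        by metis
      obtain p where p: "is_path V (E - W) (Ray p)" "p 0 = hd (q 0)"
        "\<And>k. \<exists>M. \<forall>i\<ge>M. \<exists>j\<ge>k. p i \<in> set (q j)"
        by (rule concat_finite_paths[of V "E - W" q]) (use q s_ne in auto)
      have pV: "p i \<in> V" for i using p(1) by auto
      \<comment> \<open>A vertex of \<open>q j\<close> is within \<open>\<epsilon> j\<close> of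
        \<open>x (s j)\<close>, which is within \<open>\<epsilon> j\<close> of every later term of
        \<open>x\<close>, hence the factor 2.\<close>
      have near: "extended_dist d (vertex_point V d (p i)) P \<le> ennreal (2 * \<epsilon> k)"
        if j: "j \<ge> k" "p i \<in> set (q j)" for i j k
      proof (rule self.extended_dist_le[OF vertex_point_mem[OF pV] P(1) const_mem_vertex_point[OF pV] P(2)])
        fix m assume m: "s j \<le> m"
        have "d (p i) (x m) \<le> d (p i) (x (s j)) + d (x (s j)) (x m)"
          by (intro triangle pV xV)
        also have "d (p i) (x (s j)) \<le> ennreal (\<epsilon> j)"
          using graph_dist_le_on_path[OF R q(2) j(2)] q(3,5)[of j] sym[OF pV[of i] xV[of "s j"]]
          by (auto simp: d_def)
        also have "d (x (s j)) (x m) \<le> ennreal (\<epsilon> j)"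
          using tail[of j] m unfolding tail_def by (simp add: less_imp_le)
        also have "ennreal (\<epsilon> j) + ennreal (\<epsilon> j) = ennreal (2 * \<epsilon> j)"
          using eps_pos[of j] by (simp flip: ennreal_plus)
        also have "\<dots> \<le> ennreal (2 * \<epsilon> k)"
          using eps_antimono[OF j(1)] by (intro ennreal_leI) auto
        finally show "d (p i) (x m) \<le> ennreal (2 * \<epsilon> k)" by (auto simp: add_mono)
      qed
      have "converges_to V d p P"
        unfolding converges_to_def
      proof (rule order_tendstoI)
        fix a :: ennreal assume "0 < a"
        have "(\<lambda>k. ennreal (2 * \<epsilon> k)) \<longlonglongrightarrow> ennreal (2 * 0)"
          unfolding \<epsilon>_def
          by (intro tendsto_ennrealI tendsto_mult tendsto_const LIMSEQ_Suc[OF lim_const_over_n])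
        then have "\<forall>\<^sub>F k in sequentially. ennreal (2 * \<epsilon> k) < a"
          using \<open>0 < a\<close> by (intro order_tendstoD(2)) auto
        then obtain k where k: "ennreal (2 * \<epsilon> k) < a"
          unfolding eventually_sequentially by blast
        obtain M where "\<forall>i\<ge>M. \<exists>j\<ge>k. p i \<in> set (q j)" using p(3) by blast
        then show "\<forall>\<^sub>F i in sequentially. extended_dist d (vertex_point V d (p i)) P < a"
          unfolding eventually_sequentially using near k by (meson le_less_trans)
      qed simp
      then show "\<exists>p. is_path V (E - W) (Ray p) \<and> p 0 = x n \<and> converges_to V d p P"
        using p s0 q(3) by auto
    qed
  qed
qed

lemma converges_to_prepend:
  assumes "converges_to V d p P" "\<And>i. p' (i + m) = p i"
  shows "converges_to V d p' P"
  unfolding converges_to_def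
  by (rule LIMSEQ_offset[where k = m]) (use assms in \<open>simp add: converges_to_def\<close>)

text \<open>The conclusion allows both directions because a ray can only be traversed away from its
  initial vertex: if \<open>P\<close> is reached by a ray and \<open>Q\<close> is a vertex, the path goes from \<open>Q\<close> to \<open>P\<close>.\<close>

lemma path_between_completion_points:
  assumes r: "finite_path V F r" "hd r = u" "last r = v"
    and P: "P = vertex_point V d u \<or> (\<exists>p. is_path V F (Ray p) \<and> p 0 = u \<and> converges_to V d p P)"
    and Q: "Q = vertex_point V d v \<or> (\<exists>q. is_path V F (Ray q) \<and> q 0 = v \<and> converges_to V d q Q)"
  obtains p where "is_path V F p" "path_from_to V d p P Q \<or> path_from_to V d p Q P"
proof -
  have rev: "finite_path V F (rev r)" "hd (rev r) = v" "last (rev r) = u"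
    using finite_path_rev[OF r(1)] r(2,3) by (simp_all add: hd_rev last_rev)
  consider (vertices) "P = vertex_point V d u" "Q = vertex_point V d v"
    | (ray_P) p where "Q = vertex_point V d v" "is_path V F (Ray p)" "p 0 = u" "converges_to V d p P"
    | (ray_Q) q where "P = vertex_point V d u" "is_path V F (Ray q)" "q 0 = v" "converges_to V d q Q"
    | (rays) p q where "is_path V F (Ray p)" "p 0 = u" "converges_to V d p P"
        "is_path V F (Ray q)" "q 0 = v" "converges_to V d q Q"
    using P Q by blast
  then show ?thesis
  proof cases
    case vertices
    then show ?thesis using r that[of "Finite_Path r"] by auto
  next
    case ray_P
    obtain p' m where p': "is_path V F (Ray p')" "p' 0 = v" "\<And>i. p' (i + m) = p i"
      using prepend_finite_path[OF rev(1) ray_P(2)] rev ray_P(3) by metis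
    have "converges_to V d p' P" using ray_P(4) p'(3) by (rule converges_to_prepend)
    then show ?thesis using that[OF p'(1)] p'(2) ray_P(1) by simp
  next
    case ray_Q
    obtain q' m where q': "is_path V F (Ray q')" "q' 0 = u" "\<And>i. q' (i + m) = q i"
      using prepend_finite_path[OF r(1) ray_Q(2)] r ray_Q(3) by metis
    have "converges_to V d q' Q" using ray_Q(4) q'(3) by (rule converges_to_prepend)
    then show ?thesis using that[OF q'(1)] q'(2) ray_Q(1) by simp
  next
    case rays
    \<comment> \<open>Absorbing \<open>r\<close> into the ray towards \<open>Q\<close> makes both
      rays start at \<open>u\<close>; running the one towards \<open>P\<close> backwards then gives
      a double ray.\<close>
    obtain q' m where q': "is_path V F (Ray q')" "q' 0 = u" "\<And>i. q' (i + m) = q i"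
      using prepend_finite_path[OF r(1) rays(4)] r rays(5) by metis
    have Q': "converges_to V d q' Q" using rays(6) q'(3) by (rule converges_to_prepend)
    let ?z = "\<lambda>k :: int. if 0 \<le> k then q' (nat k) else p (nat (- k))"
    have "is_path V F (Double_Ray ?z)"
      using rays q' by (intro is_path_Double_Ray) auto
    moreover have "(\<lambda>n. ?z (- int n)) = p" "(\<lambda>n. ?z (int n)) = q'"
      using rays(2) q'(2) by auto
    then have "path_from_to V d (Double_Ray ?z) P Q"
      using rays(3) Q' by simp
    ultimately show ?thesis using that by blast
  qed
qed

lemma extended_dist_pos:
  fixes V :: "'a set" and E :: "'a set set" and R0 R1 :: "'a set \<Rightarrow> real"
  defines "d0 \<equiv> graph_dist V E R0" and "d1 \<equiv> graph_dist V E R1"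
  assumes R0: "edge_length_function E R0" and R1: "edge_length_function E R1"
    and weak: "weakly_connected V E d0" and le: "\<forall>e\<in>E. R1 e \<le> R0 e"
    and P: "P \<in> graph_completion V d0" and Q: "Q \<in> graph_completion V d0" and "P \<noteq> Q"
  shows "0 < extended_dist d1 P Q"
proof -
  interpret p0: ext_pseudometric V d0
    unfolding d0_def using R0 by (rule ext_pseudometric_graph_dist)
  interpret p1: ext_pseudometric V d1
    unfolding d1_def using R1 by (rule ext_pseudometric_graph_dist)
  interpret dominated_ext_pseudometric V d0 d1
    by unfold_locales (simp add: d0_def d1_def graph_dist_mono le)
  \<comment> \<open>Rays exist only in the outward direction, so the separating sets for both orders
    of \<open>P\<close> and \<open>Q\<close> are united.\<close>
  obtain W where W: "finite W" "W \<subseteq> E"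
    and sep: "\<And>p. is_path V E p \<Longrightarrow> path_from_to V d0 p P Q \<or> path_from_to V d0 p Q P
      \<Longrightarrow> path_edges p \<inter> W \<noteq> {}"
  proof -
    obtain W W' where "finite W" "W \<subseteq> E" "finite W'" "W' \<subseteq> E"
      "\<And>p. is_path V E p \<Longrightarrow> path_from_to V d0 p P Q \<Longrightarrow> path_edges p \<inter> W \<noteq> {}"
      "\<And>p. is_path V E p \<Longrightarrow> path_from_to V d0 p Q P \<Longrightarrow> path_edges p \<inter> W' \<noteq> {}"
      using weak P Q \<open>P \<noteq> Q\<close> unfolding weakly_connected_def by metis
    then show ?thesis by (intro that[of "W \<union> W'"]) blast+
  qed
  obtain x y where x: "x \<in> P" and y: "y \<in> Q" using P Q p0.completion_nonempty by blast
  obtain M where M: "\<And>n. n \<ge> M \<Longrightarrow> P = vertex_point V d0 (x n) \<or>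
    (\<exists>p. is_path V (E - W) (Ray p) \<and> p 0 = x n \<and> converges_to V d0 p P)"
    using vertex_point_or_ray[OF R0 P[unfolded d0_def] x W] unfolding d0_def by blast
  obtain N where N: "\<And>n. n \<ge> N \<Longrightarrow> Q = vertex_point V d0 (y n) \<or>
    (\<exists>p. is_path V (E - W) (Ray p) \<and> p 0 = y n \<and> converges_to V d0 p Q)"
    using vertex_point_or_ray[OF R0 Q[unfolded d0_def] y W] unfolding d0_def by blast
  \<comment> \<open>The rays were built with \<open>R0\<close>, but the distance to be bounded is
    \<open>d1\<close>, so this constant bounds \<open>R1\<close> on \<open>W\<close>.\<close>
  obtain c where c: "c > 0" "\<And>e. e \<in> W \<Longrightarrow> c \<le> R1 e"
    using finite_edges_length_bound[OF R1 W] by blast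
  have "ennreal c \<le> d1 (x n) (y n)" if n: "n \<ge> max M N" for n
    unfolding d1_def graph_dist_def
  proof (rule INF_greatest)
    fix r assume "r \<in> {p. finite_path V E p \<and> hd p = x n \<and> last p = y n}"
    then have r: "finite_path V E r" "hd r = x n" "last r = y n" by auto
    \<comment> \<open>Otherwise \<open>r\<close>, extended by the rays at its ends where needed,
      would join \<open>P\<close> and \<open>Q\<close> without meeting \<open>W\<close>.\<close>
    have "\<not> finite_path V (E - W) r"
    proof
      assume "finite_path V (E - W) r"
      from path_between_completion_points[OF this r(2,3) M N] n
      obtain p where p: "is_path V (E - W) p" "path_from_to V d0 p P Q \<or> path_from_to V d0 p Q P"
        by auto
      have "path_edges p \<subseteq> E - W" "is_path V E p"
        using path_edges_subset[OF p(1)] is_path_mono[OF p(1)] by auto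
      then show False using sep p(2) by blast
    qed
    then obtain e where "e \<in> W" "R1 e \<le> path_length R1 r"
      using path_length_ge_edge[OF R1 r(1)] by blast
    then show "ennreal c \<le> ennreal (path_length R1 r)"
      using c(2) by (intro ennreal_leI) force
  qed
  then have "ennreal c \<le> extended_dist d1 P Q"
    using P Q x y by (intro extended_dist_ge)
  then show ?thesis using c(1) by (simp add: less_le_trans[of 0 "ennreal c"])
qed


section \<open>Topologies of extended metrics\<close>

lemma topspace_ext_metric_topology [simp]: "topspace (ext_metric_topology X D) = X"
proof -
  have "openin (ext_metric_topology X D) X"
    unfolding openin_ext_metric_topology by (auto intro: exI[of _ 1])
  then show ?thesis
    using openin_ext_metric_topology[of X D "topspace (ext_metric_topology X D)"] openin_subset
    by fastforce
qed

lemma Hausdorff_ext_metric_topology: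
  assumes "ext_metric_on X D"
  shows "Hausdorff_space (ext_metric_topology X D)"
proof -
  have zero: "D x y = 0 \<longleftrightarrow> x = y" and sym: "D x y = D y x" if "x \<in> X" "y \<in> X" for x y
    using assms that unfolding ext_metric_on_def by auto
  have tri: "D x z \<le> D x y + D y z" if "x \<in> X" "y \<in> X" "z \<in> X" for x y z
    using assms that unfolding ext_metric_on_def by auto
  have ball: "openin (ext_metric_topology X D) {y \<in> X. D x y < r}" if x: "x \<in> X" for x r
    unfolding openin_ext_metric_topology
  proof (intro conjI ballI)
    fix y assume y: "y \<in> {y \<in> X. D x y < r}"
    have "D x z < r" if z: "z \<in> X" "D y z < r - D x y" for z
    proof -
      have "D x z \<le> D x y + D y z" using x y z by (intro tri) auto
      \<comment> \<open>Since \<open>D x y < r\<close>, the distance \<open>D x y\<close> is finite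
        and can be moved across the inequality, even if \<open>r\<close> is infinite.\<close>
      also have "\<dots> < r"
        using y z(2) less_le_trans[OF _ top_greatest, of "D x y" r]
        by (simp add: less_diff_eq_ennreal add.commute)
      finally show ?thesis .
    qed
    then show "\<exists>s>0. {z \<in> X. D y z < s} \<subseteq> {y \<in> X. D x y < r}"
      using y by (intro exI[of _ "r - D x y"]) (auto simp: diff_gr0_ennreal)
  qed auto
  show ?thesis
    unfolding Hausdorff_space_def
  proof (intro allI impI)
    fix x y assume "x \<in> topspace (ext_metric_topology X D) \<and> y \<in> topspace (ext_metric_topology X D) \<and> x \<noteq> y"
    then have xy: "x \<in> X" "y \<in> X" "x \<noteq> y" by auto
    \<comment> \<open>If \<open>D x y\<close> is infinite, so is \<open>r\<close>; the two balls
      then consist of the points at finite distance from \<open>x\<close> and from \<open>y\<close>,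
      and the argument below still applies.\<close>
    define r where "r = D x y / 2"
    have r: "r + r = D x y" unfolding r_def by (rule ennreal_half_add_half)
    have "r > 0" using r zero[OF xy(1,2)] xy(3) by (cases "r = 0") (auto simp: zero_less_iff_neq_zero)
    have "\<not> (D x z < r \<and> D y z < r)" if "z \<in> X" for z
    proof
      assume "D x z < r \<and> D y z < r"
      then have "D x z + D y z < r + r" by (intro add_strict_mono) auto
      then show False using tri[of x z y] sym[of z y] xy that r by auto
    qed
    then show "\<exists>A B. openin (ext_metric_topology X D) A \<and> openin (ext_metric_topology X D) B \<and>
        x \<in> A \<and> y \<in> B \<and> disjnt A B"
      using ball[OF xy(1), of r] ball[OF xy(2), of r] xy \<open>r > 0\<close>
        zero[OF xy(1,1)] zero[OF xy(2,2)]
      by (intro exI[of _ "{z \<in> X. D x z < r}"] exI[of _ "{z \<in> X. D y z < r}"])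
        (auto simp: disjnt_iff)
  qed
qed

lemma homeomorphic_ext_metric_topology:
  assumes compact: "compact_space (ext_metric_topology X D)" and D': "ext_metric_on X D'"
    and le: "\<And>x y. x \<in> X \<Longrightarrow> y \<in> X \<Longrightarrow> D' x y \<le> D x y"
  shows "ext_metric_topology X D homeomorphic_space ext_metric_topology X D'"
proof -
  \<comment> \<open>The \<open>D\<close>-ball lies in the \<open>D'\<close>-ball of the same center
    and radius, so the topology of \<open>D'\<close> is the coarser one.\<close>
  have "openin (ext_metric_topology X D) U" if U: "openin (ext_metric_topology X D') U" for U
    unfolding openin_ext_metric_topology
  proof (intro conjI ballI)
    show "U \<subseteq> X" using U by (simp add: openin_ext_metric_topology)
    fix x assume "x \<in> U"
    then obtain r where "r > 0" "{y \<in> X. D' x y < r} \<subseteq> U" "x \<in> X"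
      using U unfolding openin_ext_metric_topology by blast
    then show "\<exists>r>0. {y \<in> X. D x y < r} \<subseteq> U"
      using le[of x] by (intro exI[of _ r]) (auto intro: le_less_trans)
  qed
  then have "continuous_map (ext_metric_topology X D) (ext_metric_topology X D') id"
    using openin_subset[of "ext_metric_topology X D'"]
    by (auto simp: continuous_map_def Collect_conj_eq Int_absorb1)
  then have "homeomorphic_map (ext_metric_topology X D) (ext_metric_topology X D') id"
    using compact Hausdorff_ext_metric_topology[OF D']
    by (intro continuous_imp_homeomorphic_map) auto
  then show ?thesis by (rule homeomorphic_map_imp_homeomorphic_space)
qed

theorem theorem2p7:
  fixes V :: "'a set" and E :: "'a set set" and R0 R1 :: "'a set \<Rightarrow> real"
  defines "d0 \<equiv> graph_dist V E R0" and "d1 \<equiv> graph_dist V E R1"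
  defines "X \<equiv> graph_completion V d0"
  assumes "locally_finite_graph V E"
    and "edge_length_function E R0" and "edge_length_function E R1"
    and "weakly_connected V E d0"
    and "\<forall>e\<in>E. R1 e \<le> R0 e"
  shows "ext_metric_on X (extended_dist d1) \<and>
    (compact_space (ext_metric_topology X (extended_dist d0)) \<longrightarrow>
       ext_metric_topology X (extended_dist d0) homeomorphic_space
       ext_metric_topology X (extended_dist d1))"
proof -
  interpret p0: ext_pseudometric V d0
    unfolding d0_def using assms(5) by (rule ext_pseudometric_graph_dist)
  interpret p1: ext_pseudometric V d1
    unfolding d1_def using assms(6) by (rule ext_pseudometric_graph_dist)
  interpret dominated_ext_pseudometric V d0 d1
    by unfold_locales (simp add: d0_def d1_def graph_dist_mono assms(8))
  \<comment> \<open>Separation of points is the only metric axiom that the extension of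
    \<open>d1\<close> does not already provide.\<close>
  have "P = Q" if "P \<in> X" "Q \<in> X" "extended_dist d1 P Q = 0" for P Q
    using extended_dist_pos[OF assms(5,6) assms(7)[unfolded d0_def] assms(8), of P Q] that
    unfolding X_def d0_def d1_def by auto
  then have metric: "ext_metric_on X (extended_dist d1)"
    unfolding ext_metric_on_def X_def
    using extended.refl extended.sym extended.triangle by blast
  moreover have "extended_dist d1 P Q \<le> extended_dist d0 P Q" if "P \<in> X" "Q \<in> X" for P Q
    using that unfolding X_def by (rule extended_dist_mono)
  ultimately show ?thesis using homeomorphic_ext_metric_topology by blast
qed

end
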